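(* Let $G:\mathbb{R}_+^N\to\mathbb{R}_+^N$ be a mapping such that $G=F_{\|\cdot\|}$ for some pair $(F,\|\cdot\|)$ satisfying the compatibility assumption (see context), and suppose that $\varrho_G\circ\mathfrak{E}:\mathbb{R}_+^N\to\mathbb{R}_+$ is convex on $\mathbb{R}_{++}^N$. Let $w\in\mathbb{R}_{++}^N$ and $\Psi(r):=-w^{\mathsf T}r$ for $r\in\mathbb{R}^N$. Then for every $b>0$ the solution set $$\operatorname{argmin}_{r\in[0,b]^N\cap\mathrm{lev}_{\le 1}(h_{G,\mathfrak{E}})}\Psi(r)$$ is a nonempty compact convex set. Moreover, if $b$ is large enough (i.e., there is a constant $c>0$ depending only on $G$ and $w$ such that this holds for all $b\ge c$), then $$\operatorname{argmin}_{r\in\mathcal{R}}\bigl(-w^{\mathsf T}r\bigr)=\operatorname{argmin}_{r\in[0,b]^N\cap\mathrm{lev}_{\le 1}(h_{G,\mathfrak{E}})}\Psi(r).$$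
   Context: Notation. $N\in\mathbb{N}=\{1,2,\ldots\}$, $\mathcal{N}=\{1,\ldots,N\}$, $\mathbb{R}_+=[0,\infty)$, $\mathbb{R}_{++}=(0,\infty)$. Vector inequalities are coordinatewise. $P_C$ is the Euclidean projection onto a nonempty closed convex set $C\subset\mathbb{R}^N$. For $h:\mathbb{R}^N\to\mathbb{R}$, $\mathrm{lev}_{\le 1}(h):=\{x\in\mathbb{R}^N: h(x)\le 1\}$. A norm $\|\cdot\|$ on $\mathbb{R}^N$ is order-preserving if $0\le x\le y$ implies $\|x\|\le\|y\|$. A function $f:\mathbb{R}_+^N\to\mathbb{R}_+$ is order-preserving if $x\le y\Rightarrow f(x)\le f(y)$, and positively homogeneous if $f(\alpha x)=\alpha f(x)$ for all $\alpha>0$ and $x\in\mathbb{R}_+^N$. A function $\mathbb{R}_+^N\to\mathbb{R}_+$ is PHOC if it is positively homogeneous, order-preserving and continuous; a mapping $\mathbb{R}_+^N\to\mathbb{R}_+^N$ is PHOC if each coordinate function is PHOC. Compatibility assumption on $(F,\|\cdot\|)$: $F=(f_n)_{n\in\mathcal{N}}:\mathbb{R}_+^N\to\mathbb{R}_{++}^N$ is continuous, $\|\cdot\|$ is an order-preserving norm on $\mathbb{R}^N$, and for each $n\in\mathcal{N}$ there exist a nonempty set $\mathcal{Y}_n$, positive scalars $(u_{n,y})_{y\in\mathcal{Y}_n}$ bounded away from zero, and PHOC functions $(g_{n,y})_{y\in\mathcal{Y}_n}$ such that $f_n(x)=\inf_{y\in\mathcal{Y}_n}(g_{n,y}(x)+u_{n,y})$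 for all $x\in\mathbb{R}_+^N$, and such that the function $(f_n)_{\|\cdot\|}(x):=\inf_{y\in\mathcal{Y}_n}(g_{n,y}(x)+u_{n,y}\|x\|)$ is continuous on $\mathbb{R}_+^N$. Then $F_{\|\cdot\|}:\mathbb{R}_+^N\to\mathbb{R}_+^N$, $x\mapsto((f_n)_{\|\cdot\|}(x))_{n\in\mathcal{N}}$, which is a PHOC mapping. Spectral radius. For a PHOC mapping $T:\mathbb{R}_+^N\to\mathbb{R}_+^N$, $\rho(T):=\sup\{\lambda\in\mathbb{R}_+:\exists x\in\mathbb{R}_+^N\setminus\{0\},\ T(x)=\lambda x\}$. For a PHOC mapping $G$, $\varrho_G:\mathbb{R}_+^N\to\mathbb{R}_+$ is $\varrho_G(x):=\rho(T_{G,x})$, where $T_{G,x}(p):=\mathrm{diag}(x)G(p)$ for $p\in\mathbb{R}_+^N$. Further objects. $\mathfrak{E}:\mathbb{R}_+^N\to\mathbb{R}_+^N$, $\mathfrak{E}(r):=(e^{r_n}-1)_{n\in\mathcal{N}}$. $\mathcal{R}:=\{r\in\mathbb{R}_+^N:(\varrho_G\circ\mathfrak{E})(r)\le 1\}$. $h_{G,\mathfrak{E}}:\mathbb{R}^N\to\mathbb{R}_+$, $h_{G,\mathfrak{E}}(r):=(\varrho_G\circ\mathfrak{E}\circ P_{\mathbb{R}_+^N})(r)$. *)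

theory Defs
  imports "HOL-Analysis.Analysis"
begin

text \<open>
  The space of real $N$-vectors is the type \<^typ>\<open>real ^ 'n\<close> with \<open>N = CARD('n)\<close>; the library order
  on it is the coordinatewise one.  Functions whose domain is the nonnegative orthant are total
  functions whose values outside the orthant are irrelevant: every hypothesis and every definition
  below only uses them on \<open>nonneg_orthant\<close>.
\<close>

definition nonneg_orthant :: "(real ^ 'n) set" where
  "nonneg_orthant = {x. 0 \<le> x}"

definition pos_orthant :: "(real ^ 'n) set" where
  "pos_orthant = {x. \<forall>i. 0 < x $ i}"

definition is_norm :: "(real ^ 'n \<Rightarrow> real) \<Rightarrow> bool" where
  "is_norm nrm \<longleftrightarrow>
     (\<forall>x. 0 \<le> nrm x) \<and>
     (\<forall>x. nrm x = 0 \<longleftrightarrow> x = 0) \<and>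
     (\<forall>a x. nrm (a *\<^sub>R x) = \<bar>a\<bar> * nrm x) \<and>
     (\<forall>x y. nrm (x + y) \<le> nrm x + nrm y)"

definition order_preserving_norm :: "(real ^ 'n \<Rightarrow> real) \<Rightarrow> bool" where
  "order_preserving_norm nrm \<longleftrightarrow>
     is_norm nrm \<and> (\<forall>x y. 0 \<le> x \<longrightarrow> x \<le> y \<longrightarrow> nrm x \<le> nrm y)"

definition PHOC :: "(real ^ 'n \<Rightarrow> real) \<Rightarrow> bool" where
  "PHOC f \<longleftrightarrow>
     (\<forall>x\<in>nonneg_orthant. 0 \<le> f x) \<and>
     (\<forall>a>0. \<forall>x\<in>nonneg_orthant. f (a *\<^sub>R x) = a * f x) \<and>
     (\<forall>x\<in>nonneg_orthant. \<forall>y\<in>nonneg_orthant. x \<le> y \<longrightarrow> f x \<le> f y) \<and>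
     continuous_on nonneg_orthant f"

text \<open>
  \<open>asym_map nrm Y g u\<close> is the mapping associated with the norm \<open>nrm\<close> and the representation of \<open>F\<close>
  by the families \<open>g n\<close> and \<open>u n\<close> indexed by \<open>Y n\<close>.
  The infima range over nonempty sets of nonnegative reals when the argument is in the orthant.
\<close>

definition asym_map ::
  "(real ^ 'n \<Rightarrow> real) \<Rightarrow> ('n \<Rightarrow> 'y set) \<Rightarrow> ('n \<Rightarrow> 'y \<Rightarrow> real ^ 'n \<Rightarrow> real) \<Rightarrow>
   ('n \<Rightarrow> 'y \<Rightarrow> real) \<Rightarrow> real ^ 'n \<Rightarrow> real ^ 'n" where
  "asym_map nrm Y g u x = (\<chi> n. INF y\<in>Y n. g n y x + u n y * nrm x)"

definition compatible ::
  "(real ^ 'n \<Rightarrow> real ^ 'n) \<Rightarrow> (real ^ 'n \<Rightarrow> real) \<Rightarrow> ('n \<Rightarrow> 'y set) \<Rightarrow>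
   ('n \<Rightarrow> 'y \<Rightarrow> real ^ 'n \<Rightarrow> real) \<Rightarrow> ('n \<Rightarrow> 'y \<Rightarrow> real) \<Rightarrow> bool" where
  "compatible F nrm Y g u \<longleftrightarrow>
     F ` nonneg_orthant \<subseteq> pos_orthant \<and>
     continuous_on nonneg_orthant F \<and>
     order_preserving_norm nrm \<and>
     (\<forall>n. Y n \<noteq> {} \<and>
          (\<exists>\<epsilon>>0. \<forall>y\<in>Y n. \<epsilon> \<le> u n y) \<and>
          (\<forall>y\<in>Y n. PHOC (g n y)) \<and>
          (\<forall>x\<in>nonneg_orthant. F x $ n = (INF y\<in>Y n. g n y x + u n y)) \<and>
          continuous_on nonneg_orthant (\<lambda>x. asym_map nrm Y g u x $ n))"

definition spectral_radius :: "(real ^ 'n \<Rightarrow> real ^ 'n) \<Rightarrow> real" where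
  "spectral_radius T =
     Sup {l. 0 \<le> l \<and> (\<exists>x\<in>nonneg_orthant - {0}. T x = l *\<^sub>R x)}"

definition scaled_map :: "(real ^ 'n \<Rightarrow> real ^ 'n) \<Rightarrow> real ^ 'n \<Rightarrow> real ^ 'n \<Rightarrow> real ^ 'n" where
  "scaled_map G x p = (\<chi> n. x $ n * G p $ n)"

definition varrho :: "(real ^ 'n \<Rightarrow> real ^ 'n) \<Rightarrow> real ^ 'n \<Rightarrow> real" where
  "varrho G x = spectral_radius (scaled_map G x)"

definition rate_map :: "real ^ 'n \<Rightarrow> real ^ 'n" where
  "rate_map r = (\<chi> n. exp (r $ n) - 1)"

definition rate_region :: "(real ^ 'n \<Rightarrow> real ^ 'n) \<Rightarrow> (real ^ 'n) set" where
  "rate_region G = {r \<in> nonneg_orthant. (varrho G \<circ> rate_map) r \<le> 1}"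

definition h_ext :: "(real ^ 'n \<Rightarrow> real ^ 'n) \<Rightarrow> real ^ 'n \<Rightarrow> real" where
  "h_ext G = varrho G \<circ> rate_map \<circ> closest_point nonneg_orthant"

definition lev1 :: "(real ^ 'n \<Rightarrow> real) \<Rightarrow> (real ^ 'n) set" where
  "lev1 h = {x. h x \<le> 1}"

definition argmin_set :: "(real ^ 'n \<Rightarrow> real) \<Rightarrow> (real ^ 'n) set \<Rightarrow> (real ^ 'n) set" where
  "argmin_set f S = {x. is_arg_min f (\<lambda>r. r \<in> S) x}"

end

theory Submission
  imports Defs
begin

text \<open>
  Let \<open>R\<close> be the rate region, the sublevel set of \<open>varrho G \<circ> rate_map\<close> at level \<open>1\<close> in the orthant.
  On a box \<open>{0..vec b}\<close> the projection onto the orthant is the identity, so the feasible set of the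
  second problem is \<open>{0..vec b} \<inter> R\<close>.  Hence it suffices that \<open>R\<close> is closed, convex, bounded and
  contains \<open>0\<close>: a linear objective on a nonempty compact convex set has a nonempty compact convex
  solution set, and once the box contains \<open>R\<close> the two problems coincide.

  The term \<open>u n y * nrm x\<close>, with \<open>u n y\<close> bounded away from zero, makes \<open>G\<close> strictly positive off the
  origin, besides being homogeneous, monotone and continuous.  Strict positivity makes
  Perron--Frobenius theory for \<open>p \<mapsto> diag(x) G(p)\<close> elementary, even for \<open>x\<close> on the boundary of
  the orthant.  The comparison argument
  \<open>eigenvalue_le\<close> shows that all eigenvalues with nonnegative eigenvectors agree, and Brouwer's theorem
  on the unit simplex provides an eigenvector, so \<open>varrho G x\<close> is characterised by a closed condition
  on pairs of \<open>x\<close> and a point of a compact simplex.  Continuity of \<open>varrho G\<close>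
  follows (\<open>continuous_on_varrho\<close>).  Continuity gives closedness of \<open>R\<close> and lets the convexity
  inequality pass from the open orthant to the closed one.  Boundedness holds because on the simplex
  \<open>G\<close> has a positive lower bound \<open>m\<close>, so \<open>varrho G x \<le> 1\<close> and an eigenvector \<open>p\<close> in the simplex give
  \<open>x\<^sub>i * m \<le> x\<^sub>i * G\<^sub>i(p) \<le> p\<^sub>i \<le> 1\<close>.
\<close>

section \<open>The simplex and the orthant\<close>

definition simplex1 :: "(real ^ 'n) set" where
  "simplex1 = {p \<in> nonneg_orthant. (\<Sum>i\<in>UNIV. p $ i) = 1}"

lemma mem_nonneg_orthant: "x \<in> nonneg_orthant \<longleftrightarrow> (\<forall>i. 0 \<le> x $ i)"
  by (simp add: nonneg_orthant_def less_eq_vec_def)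

lemma closed_nonneg_orthant: "closed (nonneg_orthant :: (real ^ 'n) set)"
  unfolding nonneg_orthant_def less_eq_vec_def Collect_all_eq
  by (intro closed_INT ballI closed_Collect_le continuous_intros)

lemma convex_nonneg_orthant: "convex (nonneg_orthant :: (real ^ 'n) set)"
  by (rule convexI) (simp add: mem_nonneg_orthant)

lemma simplex1_subset: "simplex1 \<subseteq> nonneg_orthant - {0}"
  by (auto simp: simplex1_def)

lemma simplex1_le_one: "p \<in> simplex1 \<Longrightarrow> p $ i \<le> 1"
  using member_le_sum[of i UNIV "\<lambda>i. p $ i"] by (simp add: simplex1_def mem_nonneg_orthant)

lemma compact_simplex1: "compact (simplex1 :: (real ^ 'n) set)"
proof (rule compact_eq_bounded_closed[THEN iffD2], intro conjI)
  show "bounded (simplex1 :: (real ^ 'n) set)"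
  proof (rule bounded_subset)
    show "simplex1 \<subseteq> {0..(vec 1 :: real ^ 'n)}"
      using simplex1_le_one
      by (auto simp: less_eq_vec_def) (simp add: simplex1_def mem_nonneg_orthant)
  qed (simp add: bounded_closed_interval)
  have "closed {p :: real ^ 'n. (\<Sum>i\<in>UNIV. p $ i) = 1}"
    by (intro closed_Collect_eq continuous_intros)
  then show "closed (simplex1 :: (real ^ 'n) set)"
    using closed_Int[OF closed_nonneg_orthant] by (simp add: simplex1_def Collect_conj_eq)
qed

lemma convex_simplex1: "convex (simplex1 :: (real ^ 'n) set)"
proof (rule convexI)
  fix p q :: "real ^ 'n" and a b :: real
  assume p: "p \<in> simplex1" and q: "q \<in> simplex1" and ab: "0 \<le> a" "0 \<le> b" "a + b = 1"
  have "(\<Sum>i\<in>UNIV. (a *\<^sub>R p + b *\<^sub>R q) $ i) = a * (\<Sum>i\<in>UNIV. p $ i) + b * (\<Sum>i\<in>UNIV. q $ i)"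
    by (simp add: sum.distrib sum_distrib_left)
  then show "a *\<^sub>R p + b *\<^sub>R q \<in> simplex1"
    using p q ab by (simp add: simplex1_def mem_nonneg_orthant)
qed

lemma simplex1_nonempty: "(simplex1 :: (real ^ 'n) set) \<noteq> {}"
proof -
  have "axis undefined 1 \<in> (simplex1 :: (real ^ 'n) set)"
    by (simp add: simplex1_def mem_nonneg_orthant axis_def)
  then show ?thesis by blast
qed

lemma scaled_map_nth [simp]: "scaled_map G x p $ i = x $ i * G p $ i"
  by (simp add: scaled_map_def)

lemma rate_map_nonneg: "r \<in> nonneg_orthant \<Longrightarrow> rate_map r \<in> nonneg_orthant"
  by (simp add: rate_map_def mem_nonneg_orthant)

lemma continuous_on_rate_map: "continuous_on S rate_map"
  unfolding rate_map_def by (intro continuous_intros)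

section \<open>Perron--Frobenius theory for diagonal scalings\<close>

locale positive_PHOC_map =
  fixes G :: "real ^ 'n \<Rightarrow> real ^ 'n"
  assumes hom: "\<And>a p. 0 < a \<Longrightarrow> p \<in> nonneg_orthant \<Longrightarrow> G (a *\<^sub>R p) = a *\<^sub>R G p"
    and mono: "\<And>p q. p \<in> nonneg_orthant \<Longrightarrow> q \<in> nonneg_orthant \<Longrightarrow> p \<le> q \<Longrightarrow> G p \<le> G q"
    and pos: "\<And>p i. p \<in> nonneg_orthant - {0} \<Longrightarrow> 0 < G p $ i"
    and cont: "continuous_on nonneg_orthant G"
begin

text \<open>
  Scale \<open>p\<close> down until it touches \<open>q\<close> from below, at a coordinate \<open>j\<close>; monotonicity then compares
  the eigenvalues at \<open>j\<close>.  Strict positivity of \<open>G\<close> forces \<open>q\<close> to be positive wherever \<open>x\<close> is, hence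
  wherever \<open>p\<close> is, so that the scaling factor is not zero.
\<close>
lemma eigenvalue_le:
  assumes x: "x \<in> nonneg_orthant"
    and p: "p \<in> nonneg_orthant - {0}" and q: "q \<in> nonneg_orthant - {0}"
    and eqp: "scaled_map G x p = l *\<^sub>R p" and eqq: "scaled_map G x q = m *\<^sub>R q"
    and m: "0 \<le> m"
  shows "l \<le> m"
proof (cases "l \<le> 0")
  case True
  then show ?thesis using m by simp
next
  case False
  then have l: "0 < l" by simp
  have ep: "x $ i * G p $ i = l * p $ i" and eq: "x $ i * G q $ i = m * q $ i" for i
    using arg_cong[OF eqp, of "\<lambda>v. v $ i"] arg_cong[OF eqq, of "\<lambda>v. v $ i"] by simp_all
  define I where "I = {i. 0 < p $ i}"
  have pI: "p $ i = 0" if "i \<notin> I" for i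
    using that p by (simp add: I_def mem_nonneg_orthant antisym)
  have "I \<noteq> {}"
    using p pI by (auto simp: vec_eq_iff)
  have qI: "0 < q $ i" if "i \<in> I" for i
  proof -
    have "0 < l * p $ i" using that l by (simp add: I_def)
    then have "0 < x $ i * G p $ i" by (simp only: ep)
    then have "0 < x $ i" using pos[OF p] by (rule zero_less_mult_pos2)
    then have "0 < x $ i * G q $ i" using pos[OF q] by (rule mult_pos_pos)
    then have "0 < m * q $ i" by (simp only: eq)
    then show ?thesis using m by (simp add: zero_less_mult_iff)
  qed
  obtain j where j: "j \<in> I" and jmin: "\<And>i. i \<in> I \<Longrightarrow> q $ j / p $ j \<le> q $ i / p $ i"
    using ex_min_if_finite[of "(\<lambda>i. q $ i / p $ i) ` I"] \<open>I \<noteq> {}\<close> by (force simp: not_less)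
  define t where "t = q $ j / p $ j"
  have pj: "0 < p $ j" and tp: "0 < t" using j qI by (simp_all add: I_def t_def)
  have "t * p $ i \<le> q $ i" for i
  proof (cases "i \<in> I")
    case True
    then show ?thesis using jmin[OF True] by (simp add: t_def I_def field_simps)
  next
    case False
    then show ?thesis using pI q by (simp add: mem_nonneg_orthant)
  qed
  then have "t *\<^sub>R p \<le> q" by (simp add: less_eq_vec_def)
  moreover have "t *\<^sub>R p \<in> nonneg_orthant" using p tp by (simp add: mem_nonneg_orthant)
  ultimately have "G (t *\<^sub>R p) \<le> G q" using mono q by simp
  then have "t * G p $ j \<le> G q $ j" using hom[OF tp] p by (simp add: less_eq_vec_def)
  then have "x $ j * (t * G p $ j) \<le> x $ j * G q $ j"
    using x by (intro mult_left_mono) (simp_all add: mem_nonneg_orthant)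
  also have "\<dots> = m * (t * p $ j)" using eq[of j] pj by (simp add: t_def)
  finally have "l * (t * p $ j) \<le> m * (t * p $ j)"
    using ep[of j] by (simp add: mult.left_commute)
  then show ?thesis using pj tp by simp
qed

text \<open>Uniqueness turns the supremum in the definition of the spectral radius into an evaluation.\<close>
lemma varrho_eqI:
  assumes x: "x \<in> nonneg_orthant" and p: "p \<in> nonneg_orthant - {0}"
    and eqp: "scaled_map G x p = l *\<^sub>R p" and l: "0 \<le> l"
  shows "varrho G x = l"
proof -
  have "{l. 0 \<le> l \<and> (\<exists>q\<in>nonneg_orthant - {0}. scaled_map G x q = l *\<^sub>R q)} = {l}"
    using eigenvalue_le[OF x] assms by (force intro: antisym)
  then show ?thesis by (simp add: varrho_def spectral_radius_def)
qed

lemma scaled_sum_nonneg: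
  assumes "x \<in> nonneg_orthant" "p \<in> simplex1"
  shows "0 \<le> (\<Sum>i\<in>UNIV. x $ i * G p $ i)"
proof -
  have "p \<in> nonneg_orthant - {0}" using assms simplex1_subset by blast
  then show ?thesis
    using assms(1) by (intro sum_nonneg mult_nonneg_nonneg) (simp_all add: mem_nonneg_orthant pos less_imp_le)
qed

text \<open>
  Brouwer's theorem applied to the map that renormalises \<open>diag(x) G(p)\<close> to have coordinate sum one;
  positivity of \<open>G\<close> keeps the normalising sum from vanishing as soon as \<open>x\<close> is not zero.
\<close>
lemma eigenvector_exists:
  assumes x: "x \<in> nonneg_orthant"
  obtains p where "p \<in> simplex1" "scaled_map G x p = (\<Sum>i\<in>UNIV. x $ i * G p $ i) *\<^sub>R p"
proof (cases "x = 0")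
  case True
  obtain p :: "real ^ 'n" where "p \<in> simplex1" using simplex1_nonempty by blast
  with True show ?thesis using that by (auto simp: vec_eq_iff)
next
  case False
  then obtain k where k: "x $ k \<noteq> 0" by (auto simp: vec_eq_iff)
  then have k: "0 < x $ k" using x by (metis mem_nonneg_orthant order_le_less)
  define s where "s p = (\<Sum>i\<in>UNIV. x $ i * G p $ i)" for p
  have s: "0 < s p" if "p \<in> simplex1" for p
  proof -
    have G: "0 < G p $ i" for i using that simplex1_subset pos by blast
    then have "0 < x $ k * G p $ k" using k by simp
    moreover have "0 \<le> x $ i * G p $ i" for i using x G[of i] by (simp add: mem_nonneg_orthant)
    ultimately show ?thesis unfolding s_def by (intro sum_pos2[of _ k]) auto
  qed
  define f where "f p = (1 / s p) *\<^sub>R scaled_map G x p" for p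
  have cG: "continuous_on simplex1 G"
    using cont simplex1_subset continuous_on_subset by blast
  have "continuous_on simplex1 f"
    unfolding f_def scaled_map_def
    using s unfolding s_def by (intro continuous_intros cG) force
  moreover have "f p \<in> simplex1" if p: "p \<in> simplex1" for p
  proof -
    have "0 < G p $ i" for i using p simplex1_subset pos by blast
    then have "f p \<in> nonneg_orthant"
      using s[OF p] x by (simp add: f_def mem_nonneg_orthant less_imp_le)
    moreover have "(\<Sum>i\<in>UNIV. f p $ i) = s p / s p"
      by (simp add: f_def s_def flip: sum_divide_distrib)
    ultimately show ?thesis using s[OF p] by (simp add: simplex1_def)
  qed
  ultimately obtain p where p: "p \<in> simplex1" "f p = p"
    using brouwer[OF compact_simplex1 convex_simplex1 simplex1_nonempty, of f] by blast
  have "scaled_map G x p = s p *\<^sub>R f p" using s[OF p(1)] by (simp add: f_def)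
  then show ?thesis using p that by (simp add: s_def)
qed

lemma varrho_mem_iff:
  assumes x: "x \<in> nonneg_orthant"
  shows "varrho G x \<in> B \<longleftrightarrow>
    (\<exists>p\<in>simplex1. scaled_map G x p = (\<Sum>i\<in>UNIV. x $ i * G p $ i) *\<^sub>R p \<and> (\<Sum>i\<in>UNIV. x $ i * G p $ i) \<in> B)"
  using eigenvector_exists[OF x] varrho_eqI[OF x] scaled_sum_nonneg[OF x] simplex1_subset
  by (smt (verit, best) subset_iff)

text \<open>
  Preimages of closed sets are projections, along the compact simplex, of closed sets of pairs, and
  such projections are closed.
\<close>
lemma continuous_on_varrho: "continuous_on nonneg_orthant (varrho G)"
  unfolding continuous_on_closed_vimage[OF closed_nonneg_orthant]
proof (intro allI impI)
  fix B :: "real set" assume B: "closed B"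
  define D where "D = (simplex1 :: (real ^ 'n) set) \<times> (nonneg_orthant :: (real ^ 'n) set)"
  have D: "closed D"
    by (simp add: D_def closed_Times compact_imp_closed compact_simplex1 closed_nonneg_orthant)
  define s where "s z = (\<Sum>i\<in>UNIV. snd z $ i * G (fst z) $ i)" for z
  have cG: "continuous_on D (\<lambda>z. G (fst z))"
    using simplex1_subset unfolding D_def
    by (intro continuous_on_compose2[OF cont] continuous_intros) auto
  have cs: "continuous_on D s"
    unfolding s_def by (intro continuous_intros cG)
  have ce: "continuous_on D (\<lambda>z. scaled_map G (snd z) (fst z) - s z *\<^sub>R fst z)"
    unfolding scaled_map_def by (intro continuous_intros cG cs)
  define Z where "Z = (D \<inter> (\<lambda>z. scaled_map G (snd z) (fst z) - s z *\<^sub>R fst z) -` {0}) \<inter> (D \<inter> s -` B)"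
  have "closed Z"
    unfolding Z_def
    by (intro closed_Int continuous_closed_preimage ce cs D B closed_singleton)
  then have "closed {x. \<exists>p. p \<in> simplex1 \<and> (p, x) \<in> Z}"
    by (rule closed_compact_projection[OF compact_simplex1])
  moreover have "{x. \<exists>p. p \<in> simplex1 \<and> (p, x) \<in> Z} = varrho G -` B \<inter> nonneg_orthant"
    using varrho_mem_iff by (auto simp: Z_def D_def s_def)
  ultimately show "closed (varrho G -` B \<inter> nonneg_orthant)" by simp
qed

section \<open>The rate region\<close>

lemma continuous_on_varrho_rate_map: "continuous_on nonneg_orthant (varrho G \<circ> rate_map)"
  using rate_map_nonneg
  by (intro continuous_on_compose continuous_on_rate_map continuous_on_subset[OF continuous_on_varrho]) auto

lemma zero_in_rate_region: "0 \<in> rate_region G"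
proof -
  obtain p :: "real ^ 'n" where p: "p \<in> nonneg_orthant - {0}"
    using simplex1_nonempty simplex1_subset by blast
  have "scaled_map G (rate_map 0) p = 0 *\<^sub>R p" by (simp add: vec_eq_iff rate_map_def)
  from varrho_eqI[OF rate_map_nonneg p this] show ?thesis
    by (simp add: rate_region_def mem_nonneg_orthant)
qed

lemma closed_rate_region: "closed (rate_region G)"
proof -
  have "rate_region G = nonneg_orthant \<inter> (varrho G \<circ> rate_map) -` {..1}"
    by (auto simp: rate_region_def)
  then show ?thesis
    using continuous_closed_preimage[OF continuous_on_varrho_rate_map closed_nonneg_orthant closed_atMost]
    by simp
qed

text \<open>
  Convexity is only assumed on the open orthant, so both endpoints are shifted by a small positive
  vector, and the shift is then sent to zero.
\<close>
lemma convex_rate_region: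
  assumes conv: "convex_on pos_orthant (varrho G \<circ> rate_map)"
  shows "convex (rate_region G)"
proof (rule convexI)
  fix r s :: "real ^ 'n" and a b :: real
  assume r: "r \<in> rate_region G" and s: "s \<in> rate_region G" and ab: "0 \<le> a" "0 \<le> b" "a + b = 1"
  define f where "f = varrho G \<circ> rate_map"
  define e :: "nat \<Rightarrow> real ^ 'n" where "e k = vec (inverse (real (Suc k)))" for k
  have "e \<longlonglongrightarrow> vec 0"
    unfolding e_def by (intro vec_tendstoI) (simp add: LIMSEQ_inverse_real_of_nat del: of_nat_Suc)
  then have e0: "e \<longlonglongrightarrow> 0" by simp
  have rs: "r \<in> nonneg_orthant" "s \<in> nonneg_orthant" and f1: "f r \<le> 1" "f s \<le> 1"
    using r s by (auto simp: rate_region_def f_def)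
  have c: "a *\<^sub>R r + b *\<^sub>R s \<in> nonneg_orthant"
    using convexD[OF convex_nonneg_orthant rs ab] .
  have shift: "v + e k \<in> pos_orthant" "v + e k \<in> nonneg_orthant" if "v \<in> nonneg_orthant" for v k
    using that by (simp_all add: mem_nonneg_orthant pos_orthant_def e_def add_nonneg_pos del: of_nat_Suc)
  have lim: "(\<lambda>k. f (v + e k)) \<longlonglongrightarrow> f v" if v: "v \<in> nonneg_orthant" for v
  proof (rule continuous_on_tendsto_compose[OF continuous_on_varrho_rate_map[folded f_def]])
    show "(\<lambda>k. v + e k) \<longlonglongrightarrow> v" using tendsto_add[OF tendsto_const e0] by simp
  qed (use v shift in auto)
  have "f (a *\<^sub>R r + b *\<^sub>R s + e k) \<le> a * f (r + e k) + b * f (s + e k)" for k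
  proof -
    have "a *\<^sub>R r + b *\<^sub>R s + e k = a *\<^sub>R (r + e k) + b *\<^sub>R (s + e k)"
      using ab by (simp add: algebra_simps flip: scaleR_add_left)
    then show ?thesis
      using conv[folded f_def] shift rs ab by (simp add: convex_on_def)
  qed
  moreover have "(\<lambda>k. a * f (r + e k) + b * f (s + e k)) \<longlonglongrightarrow> a * f r + b * f s"
    by (intro tendsto_intros lim rs)
  ultimately have "f (a *\<^sub>R r + b *\<^sub>R s) \<le> a * f r + b * f s"
    using lim[OF c] LIMSEQ_le by blast
  also have "\<dots> \<le> 1"
    using f1 ab convex_bound_le by blast
  finally show "a *\<^sub>R r + b *\<^sub>R s \<in> rate_region G"
    using c by (simp add: rate_region_def f_def)
qed

text \<open>
  On the compact simplex the coordinates of \<open>G\<close> have a common positive lower bound \<open>m\<close>.  Reading the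
  eigenvector equation coordinatewise then gives \<open>exp r\<^sub>i - 1 \<le> 1 / m\<close>.
\<close>
lemma rate_region_bounded:
  obtains c where "0 < c" "rate_region G \<subseteq> {0..vec c}"
proof -
  have "\<exists>p\<in>simplex1. \<forall>q\<in>simplex1. G p $ i \<le> G q $ i" for i
    using cont simplex1_subset
    by (intro continuous_attains_inf compact_simplex1 simplex1_nonempty continuous_intros)
      (blast intro: continuous_on_subset)
  then obtain P where P: "\<And>i. P i \<in> simplex1" "\<And>i q. q \<in> simplex1 \<Longrightarrow> G (P i) $ i \<le> G q $ i"
    by metis
  define m where "m = Min (range (\<lambda>i. G (P i) $ i))"
  have m: "0 < m" using P(1) simplex1_subset pos by (simp add: m_def) blast
  have Gm: "m \<le> G q $ i" if "q \<in> simplex1" for q i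
    using P(2)[OF that, of i] Min_le[of "range (\<lambda>i. G (P i) $ i)" "G (P i) $ i"]
    by (simp add: m_def del: Min_le)
  have "r $ i \<le> 1 / m" if r: "r \<in> rate_region G" for r i
  proof -
    have r0: "r \<in> nonneg_orthant" and le: "varrho G (rate_map r) \<le> 1"
      using r by (auto simp: rate_region_def)
    have x: "rate_map r \<in> nonneg_orthant" by (rule rate_map_nonneg[OF r0])
    obtain p where p: "p \<in> simplex1"
      and eq: "scaled_map G (rate_map r) p = (\<Sum>i\<in>UNIV. rate_map r $ i * G p $ i) *\<^sub>R p"
      using eigenvector_exists[OF x] by blast
    have p0: "p \<in> nonneg_orthant - {0}" using p simplex1_subset by blast
    have "varrho G (rate_map r) = (\<Sum>i\<in>UNIV. rate_map r $ i * G p $ i)"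
      by (rule varrho_eqI[OF x p0 eq scaled_sum_nonneg[OF x p]])
    then have "rate_map r $ i * G p $ i = varrho G (rate_map r) * p $ i"
      using arg_cong[OF eq, of "\<lambda>v. v $ i"] by simp
    also have "\<dots> \<le> 1 * 1"
      using le simplex1_le_one[OF p] p0 by (intro mult_mono) (auto simp: mem_nonneg_orthant)
    finally have "rate_map r $ i * G p $ i \<le> 1" by simp
    moreover have "rate_map r $ i * m \<le> rate_map r $ i * G p $ i"
      using Gm[OF p] x by (intro mult_left_mono) (simp_all add: mem_nonneg_orthant)
    moreover have "r $ i \<le> rate_map r $ i"
      using exp_ge_add_one_self[of "r $ i"] unfolding rate_map_def vec_lambda_beta by linarith
    ultimately show ?thesis using m
      by (smt (verit, ccfv_SIG) pos_le_divide_eq)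
  qed
  then have "rate_region G \<subseteq> {0..vec (1 / m)}"
    by (auto simp: less_eq_vec_def) (simp add: rate_region_def mem_nonneg_orthant)
  then show ?thesis using that[of "1 / m"] m by simp
qed

end

section \<open>Compatible pairs\<close>

text \<open>
  Strict positivity comes from the uniform bound \<open>\<epsilon> * nrm x\<close> below all members of the family, which
  survives the infimum; homogeneity and monotonicity pass from the members to the infimum.
\<close>
lemma compatible_positive_PHOC_map:
  fixes G F :: "real ^ 'n \<Rightarrow> real ^ 'n"
  assumes comp: "compatible F nrm Y g u"
    and G: "\<forall>x\<in>nonneg_orthant. G x = asym_map nrm Y g u x"
  shows "positive_PHOC_map G"
proof -
  have nrm: "is_norm nrm" and op: "\<And>x y. 0 \<le> x \<Longrightarrow> x \<le> y \<Longrightarrow> nrm x \<le> nrm y"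
    using comp by (auto simp: compatible_def order_preserving_norm_def)
  have nn: "0 \<le> nrm x" "nrm x = 0 \<longleftrightarrow> x = 0" and nh: "nrm (a *\<^sub>R x) = \<bar>a\<bar> * nrm x" for x a
    using nrm by (auto simp: is_norm_def)
  have Y: "Y n \<noteq> {}" for n using comp by (simp add: compatible_def)
  have "\<exists>\<epsilon>>0. \<forall>y\<in>Y n. \<epsilon> \<le> u n y" for n
    using comp by (simp add: compatible_def)
  then obtain \<epsilon> where \<epsilon>: "\<And>n. 0 < \<epsilon> n" and u: "\<And>n y. y \<in> Y n \<Longrightarrow> \<epsilon> n \<le> u n y" by metis
  have u0: "0 \<le> u n y" if "y \<in> Y n" for n y using u[OF that] \<epsilon>[of n] by linarith
  have P: "PHOC (g n y)" if "y \<in> Y n" for n y using comp that by (simp add: compatible_def)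
  have GI: "G x $ n = (INF y\<in>Y n. g n y x + u n y * nrm x)" if "x \<in> nonneg_orthant" for x n
    using G that by (simp add: asym_map_def)
  have low: "\<epsilon> n * nrm x \<le> g n y x + u n y * nrm x" if "y \<in> Y n" "x \<in> nonneg_orthant" for n x y
  proof -
    have "0 \<le> g n y x" using P[OF that(1)] that(2) by (simp add: PHOC_def)
    moreover have "\<epsilon> n * nrm x \<le> u n y * nrm x" using u[OF that(1)] nn by (intro mult_right_mono)
    ultimately show ?thesis by simp
  qed
  have Gle: "G x $ n \<le> g n y x + u n y * nrm x" if "y \<in> Y n" "x \<in> nonneg_orthant" for n x y
    unfolding GI[OF that(2)]
    using low that by (intro cINF_lower bdd_belowI2[where m = "\<epsilon> n * nrm x"]) auto
  have Gge: "c \<le> G x $ n" if "x \<in> nonneg_orthant" "\<And>y. y \<in> Y n \<Longrightarrow> c \<le> g n y x + u n y * nrm x" for n x c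
    unfolding GI[OF that(1)] using that(2) Y by (intro cINF_greatest) auto
  have orth: "a *\<^sub>R x \<in> nonneg_orthant" if "0 < a" "x \<in> nonneg_orthant" for a and x :: "real ^ 'n"
    using that by (simp add: mem_nonneg_orthant)
  have half: "G (a *\<^sub>R x) $ n \<le> a * G x $ n" if a: "0 < a" and x: "x \<in> nonneg_orthant" for a x n
  proof -
    have "G (a *\<^sub>R x) $ n / a \<le> G x $ n"
    proof (rule Gge[OF x])
      fix y assume y: "y \<in> Y n"
      have "g n y (a *\<^sub>R x) = a * g n y x" using P[OF y] a x by (simp add: PHOC_def)
      then have "G (a *\<^sub>R x) $ n \<le> a * (g n y x + u n y * nrm x)"
        using Gle[OF y orth[OF a x]] a by (simp add: nh algebra_simps)
      then show "G (a *\<^sub>R x) $ n / a \<le> g n y x + u n y * nrm x" using a by (simp add: field_simps)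
    qed
    then show ?thesis using a by (simp add: field_simps)
  qed
  show ?thesis
  proof
    fix a :: real and p :: "real ^ 'n" assume a: "0 < a" and p: "p \<in> nonneg_orthant"
    have "a * G p $ n \<le> G (a *\<^sub>R p) $ n" for n
      \<comment> \<open>the inequality just proved, with \<open>1 / a\<close> and \<open>a *\<^sub>R p\<close> in place of \<open>a\<close> and \<open>p\<close>\<close>
      using half[of "1 / a" "a *\<^sub>R p" n] orth[OF a p] a by (simp add: field_simps)
    then show "G (a *\<^sub>R p) = a *\<^sub>R G p"
      using half[OF a p] by (simp add: vec_eq_iff antisym)
  next
    fix p q :: "real ^ 'n" assume pq: "p \<in> nonneg_orthant" "q \<in> nonneg_orthant" "p \<le> q"
    have "G p $ n \<le> G q $ n" for n
    proof (rule Gge[OF pq(2)])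
      fix y assume y: "y \<in> Y n"
      have "g n y p \<le> g n y q" using P[OF y] pq by (simp add: PHOC_def)
      moreover have "u n y * nrm p \<le> u n y * nrm q"
        using op pq u0[OF y] by (intro mult_left_mono) (simp_all add: nonneg_orthant_def)
      ultimately show "G p $ n \<le> g n y q + u n y * nrm q" using Gle[OF y pq(1)] by linarith
    qed
    then show "G p \<le> G q" by (simp add: less_eq_vec_def)
  next
    fix p :: "real ^ 'n" and i assume p: "p \<in> nonneg_orthant - {0}"
    then have "0 < nrm p" using nn by (metis DiffD2 order_le_less singletonI)
    then have "0 < \<epsilon> i * nrm p" using \<epsilon> by simp
    also have "\<dots> \<le> G p $ i" using p low by (intro Gge) auto
    finally show "0 < G p $ i" .
  next
    have "continuous_on nonneg_orthant (\<lambda>x. \<chi> n. asym_map nrm Y g u x $ n)"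
      using comp by (intro continuous_on_vec_lambda) (simp add: compatible_def)
    then show "continuous_on nonneg_orthant G"
      using G by (simp cong: continuous_on_cong)
  qed
qed

section \<open>Linear minimisation over the rate region\<close>

lemma argmin_set_linear:
  fixes w :: "real ^ 'n"
  assumes S: "compact S" "convex S" "S \<noteq> {}"
  shows "argmin_set (\<lambda>r. - (w \<bullet> r)) S \<noteq> {} \<and> compact (argmin_set (\<lambda>r. - (w \<bullet> r)) S) \<and>
    convex (argmin_set (\<lambda>r. - (w \<bullet> r)) S)"
proof -
  have "continuous_on S (\<lambda>r. w \<bullet> r)" by (intro continuous_intros)
  then obtain z where z: "z \<in> S" "\<And>r. r \<in> S \<Longrightarrow> w \<bullet> r \<le> w \<bullet> z"
    using continuous_attains_sup[OF S(1,3)] by metis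
  have "argmin_set (\<lambda>r. - (w \<bullet> r)) S = S \<inter> {r. w \<bullet> r = w \<bullet> z}"
    using z by (force simp: argmin_set_def is_arg_min_def)
  then show ?thesis
    using z S by (auto intro: compact_Int_closed closed_hyperplane convex_Int convex_hyperplane)
qed

theorem mainTheorem2:
  fixes G F :: "real ^ 'n \<Rightarrow> real ^ 'n"
    and nrm :: "real ^ 'n \<Rightarrow> real"
    and Y :: "'n \<Rightarrow> 'y set"
    and g :: "'n \<Rightarrow> 'y \<Rightarrow> real ^ 'n \<Rightarrow> real"
    and u :: "'n \<Rightarrow> 'y \<Rightarrow> real"
    and w :: "real ^ 'n"
    and \<Psi> :: "real ^ 'n \<Rightarrow> real"
  assumes "compatible F nrm Y g u"
    and "\<forall>x\<in>nonneg_orthant. G x = asym_map nrm Y g u x"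
    and "convex_on pos_orthant (varrho G \<circ> rate_map)"
    and "w \<in> pos_orthant"
    and "\<Psi> = (\<lambda>r. - (w \<bullet> r))"
  shows "(\<forall>b>0.
            argmin_set \<Psi> ({0..vec b} \<inter> lev1 (h_ext G)) \<noteq> {} \<and>
            compact (argmin_set \<Psi> ({0..vec b} \<inter> lev1 (h_ext G))) \<and>
            convex (argmin_set \<Psi> ({0..vec b} \<inter> lev1 (h_ext G)))) \<and>
         (\<exists>c>0. \<forall>b\<ge>c.
            argmin_set (\<lambda>r. - (w \<bullet> r)) (rate_region G) =
            argmin_set \<Psi> ({0..vec b} \<inter> lev1 (h_ext G)))"
proof -
  interpret positive_PHOC_map G
    by (rule compatible_positive_PHOC_map[OF assms(1,2)])
  have feas: "{0..vec b} \<inter> lev1 (h_ext G) = {0..vec b} \<inter> rate_region G" for b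
    by (auto simp: lev1_def h_ext_def rate_region_def nonneg_orthant_def closest_point_self)
  have "argmin_set \<Psi> ({0..vec b} \<inter> rate_region G) \<noteq> {} \<and>
      compact (argmin_set \<Psi> ({0..vec b} \<inter> rate_region G)) \<and>
      convex (argmin_set \<Psi> ({0..vec b} \<inter> rate_region G))" if b: "0 < b" for b
    unfolding assms(5)
  proof (rule argmin_set_linear)
    show "compact ({0..vec b} \<inter> rate_region G)"
      by (intro compact_Int_closed closed_rate_region) (simp add: interval_cbox_cart)
    show "convex ({0..vec b} \<inter> rate_region G)"
      by (intro convex_Int convex_rate_region assms(3)) (simp add: interval_cbox_cart)
    have "0 \<in> {0..(vec b :: real ^ 'n)}" using b by (simp add: less_eq_vec_def)
    then show "{0..vec b} \<inter> rate_region G \<noteq> {}" using zero_in_rate_region by blast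
  qed
  moreover obtain c where c: "0 < c" "rate_region G \<subseteq> {0..vec c}"
    using rate_region_bounded by blast
  have "rate_region G = {0..vec b} \<inter> rate_region G" if "c \<le> b" for b
  proof -
    have "vec c \<le> (vec b :: real ^ 'n)" using that by (simp add: less_eq_vec_def)
    then show ?thesis using c(2) by fastforce
  qed
  then have "\<forall>b\<ge>c. argmin_set (\<lambda>r. - (w \<bullet> r)) (rate_region G) =
      argmin_set \<Psi> ({0..vec b} \<inter> rate_region G)"
    using assms(5) by metis
  ultimately show ?thesis unfolding feas using c(1) by blast
qed

end
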